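(* The generating function $R(x)=\sum_{n\geq 0}|I_n(100,021)|\,x^{n+1}$ is given by $$R(x)=\frac{(1-3x)^2}{2x^2\sqrt{1-4x}}-\frac{(1-3x)(1-x)}{2x^2}.$$ Moreover, $|I_n(100,021)|=\dfrac{n^2+n+6}{2(n+3)(n+2)}\dbinom{2n+2}{n+1}$ for all $n\geq 0$.
   Context: For $n\ge 0$, $I_n$ denotes the set of inversion sequences $e=e_0e_1\cdots e_n$, i.e. integer sequences with $0\le e_i\le i$ for each $0\le i\le n$ (so elements of $I_n$ have $n+1$ letters). An inversion sequence contains a pattern (word) $\tau$ of length $k$ if it has a subsequence (not necessarily consecutive) of length $k$ that is order isomorphic to $\tau$ (same relative order, including equalities); otherwise it avoids $\tau$. $I_n(\tau_1,\dots,\tau_m)$ is the set of $e\in I_n$ avoiding all of $\tau_1,\dots,\tau_m$. Generating functions are formal power series in $x$ (the right-hand side is expanded as a Laurent series at $x=0$, with $\sqrt{\cdot}$ having constant term $1$). *)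

theory Defs
  imports
    "HOL-Library.Sublist"
    "HOL-Computational_Algebra.Formal_Laurent_Series"
begin

text \<open>Note the index shift: the elements of \<open>inv_seqs n\<close> are words
  \<open>e\<^sub>0 e\<^sub>1 \<dots> e\<^sub>n\<close> with \<open>n + 1\<close> letters.\<close>

definition inv_seqs :: "nat \<Rightarrow> nat list set" where
  "inv_seqs n = {e. length e = n + 1 \<and> (\<forall>i\<le>n. e ! i \<le> i)}"

definition order_isomorphic :: "nat list \<Rightarrow> nat list \<Rightarrow> bool" where
  "order_isomorphic u v \<longleftrightarrow> length u = length v \<and>
     (\<forall>i<length u. \<forall>j<length u.
        (u ! i < u ! j \<longleftrightarrow> v ! i < v ! j) \<and> (u ! i = u ! j \<longleftrightarrow> v ! i = v ! j))"

definition contains_pattern :: "nat list \<Rightarrow> nat list \<Rightarrow> bool" where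
  "contains_pattern e \<tau> \<longleftrightarrow> (\<exists>u. subseq u e \<and> order_isomorphic u \<tau>)"

definition inv_seqs_avoiding :: "nat \<Rightarrow> nat list set \<Rightarrow> nat list set" where
  "inv_seqs_avoiding n T = {e \<in> inv_seqs n. \<forall>\<tau>\<in>T. \<not> contains_pattern e \<tau>}"

definition R_gf :: "real fps" where
  "R_gf = Abs_fps (\<lambda>m. case m of 0 \<Rightarrow> 0
     | Suc n \<Rightarrow> of_nat (card (inv_seqs_avoiding n {[1,0,0], [0,2,1]})))"

text \<open>The square root of a power series with constant term \<open>1\<close>, normalised to have
  constant term \<open>root 2 1 = 1\<close>.\<close>

definition fps_sqrt :: "real fps \<Rightarrow> real fps" where
  "fps_sqrt F = fps_radical root 2 F"

end

theory Submission
  imports Defs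
begin

text \<open>
  An inversion sequence starts with \<open>0\<close>.  Hence it avoids \<open>021\<close> exactly if its positive letters
  are weakly increasing (lemma \<open>contains_021_iff\<close>), and then a copy of \<open>100\<close> can only consist of a
  positive letter and two later zeros (lemma \<open>contains_100_iff\<close>).  So the words to be counted are
  the inversion sequences with weakly increasing positive letters and at most one \<^emph>\<open>inner zero\<close>, that is, a zero after the first positive letter.

  Let \<open>A\<^sub>d(N, m)\<close> be the number of inversion sequences with \<open>N\<close> letters, all of them at most \<open>m\<close>,
  whose positive letters are weakly increasing and which have exactly \<open>d\<close> inner zeros.
  A word counted by \<open>A\<^sub>d(N + 1, m + 1)\<close> whose maximum is \<open>m + 1\<close> ends in \<open>m + 1\<close>
  or in an inner zero, which gives
  \<open>A\<^sub>d(N + 1, m + 1) = A\<^sub>d(N + 1, m) + A\<^sub>d(N, m + 1) + (A\<^sub>d\<^sub>-\<^sub>1(N, m + 1) - A\<^sub>d\<^sub>-\<^sub>1(N, m))\<close>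
  for \<open>m + 1 \<le> N\<close> (lemma \<open>card_admissibles_Suc_Suc\<close>), without the bracket if \<open>d = 0\<close>.
  For \<open>d = 0\<close> this is the recurrence of the ballot numbers; for \<open>d = 1\<close> the solution is again a combination of binomial coefficients
  (lemma \<open>card_admissibles_1\<close>).  Summing over \<open>d \<le> 1\<close> gives
  \<open>(2n+1 choose n) - (2n+1 choose n+2) + (2n+1 choose n+3)\<close> words with \<open>n + 1\<close> letters,
  which is the stated closed form.

  For the generating function, \<open>D = \<Sum>\<^sub>n (2n choose n) x\<^sup>n\<close> satisfies \<open>(1 - 4x) D' = 2 D\<close>, so
  \<open>D\<^sup>2 (1 - 4x)\<close> has derivative \<open>0\<close> and constant term \<open>1\<close>, and \<open>D\<close> is the inverse of the square root of \<open>1 - 4x\<close>.  The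
  closed form then turns the claimed identity into a comparison of the coefficients of
  \<open>2x\<^sup>2 R\<close> and \<open>(1 - 3x)\<^sup>2 D - (1 - 3x)(1 - x)\<close>.
\<close>

section \<open>Words avoiding the two patterns\<close>

lemma order_isomorphic_100:
  "order_isomorphic [a, b, c] [1, 0, 0] \<longleftrightarrow> b < a \<and> c = b"
  by (simp add: order_isomorphic_def All_less_Suc) auto

lemma order_isomorphic_021:
  "order_isomorphic [a, b, c] [0, 2, 1] \<longleftrightarrow> a < c \<and> c < b"
  by (simp add: order_isomorphic_def All_less_Suc) auto

lemma order_isomorphic_tripleE:
  assumes "order_isomorphic u [x, y, z]"
  obtains a b c where "u = [a, b, c]"
proof -
  have "length u = 3"
    using assms by (simp add: order_isomorphic_def)
  then show ?thesis
    using that by (auto simp: eval_nat_numeral length_Suc_conv)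
qed

lemma contains_pattern_triple:
  "contains_pattern e [x, y, z] \<longleftrightarrow>
     (\<exists>a b c. subseq [a, b, c] e \<and> order_isomorphic [a, b, c] [x, y, z])"
  unfolding contains_pattern_def by (metis order_isomorphic_tripleE)

lemma contains_100:
  "contains_pattern e [1, 0, 0] \<longleftrightarrow> (\<exists>a b. subseq [a, b, b] e \<and> b < a)"
  unfolding contains_pattern_triple order_isomorphic_100 by auto

lemma contains_021:
  "contains_pattern e [0, 2, 1] \<longleftrightarrow> (\<exists>a b c. subseq [a, b, c] e \<and> a < c \<and> c < b)"
  unfolding contains_pattern_triple order_isomorphic_021 by auto

lemma sorted_iff_subseq:
  "sorted xs \<longleftrightarrow> (\<forall>b c. subseq [b, c] xs \<longrightarrow> b \<le> (c :: 'a :: linorder))"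
proof (induction xs)
  case (Cons x xs)
  have "subseq [b, c] (x # xs) \<longleftrightarrow> (b = x \<and> c \<in> set xs) \<or> subseq [b, c] xs" for b c
    using subseq_order.order_trans[of "[c]" "[b, c]" xs]
    by (auto simp: subseq_Cons2_iff subseq_singleton_left)
  then show ?case
    using Cons by auto
qed auto

lemma subseq_replicate_iff_count_list:
  "subseq (replicate k x) xs \<longleftrightarrow> k \<le> count_list xs x"
proof (induction xs arbitrary: k)
  case Nil
  show ?case
    by (cases k) auto
next
  case (Cons y xs)
  show ?case
  proof (cases k)
    case (Suc j)
    then show ?thesis
      using Cons[of j] Cons[of k] by (auto simp: subseq_Cons2_iff)
  qed auto
qed

text \<open>The number of zeros after the first positive letter.\<close>
definition inner_zeros :: "nat list \<Rightarrow> nat" where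
  "inner_zeros e = count_list (dropWhile (\<lambda>x. x = 0) e) 0"

lemma inner_zeros_snoc:
  "inner_zeros (e @ [x]) =
     inner_zeros e + (if x = 0 \<and> (\<exists>y\<in>set e. y \<noteq> 0) then 1 else 0)"
proof (cases "\<exists>y\<in>set e. y \<noteq> 0")
  case True
  then show ?thesis
    by (auto simp: inner_zeros_def dropWhile_append)
next
  case False
  then have "dropWhile (\<lambda>x. x = 0) (e @ [x]) = dropWhile (\<lambda>x. x = 0) [x]"
    by (intro dropWhile_append2) auto
  moreover have "dropWhile (\<lambda>x. x = 0) e = []"
    using False by (simp only: dropWhile_eq_Nil_conv) blast
  ultimately show ?thesis
    unfolding inner_zeros_def using False by (simp del: dropWhile_eq_Nil_conv)
qed

lemma subseq_dropWhile:
  "\<not> P a \<Longrightarrow> subseq (a # us) xs \<Longrightarrow> subseq (a # us) (dropWhile P xs)"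
proof (induction xs)
  case (Cons x xs)
  then show ?case
    by (cases "a = x") (auto simp: subseq_Cons2_iff)
qed auto

lemma contains_021_iff:
  assumes "e \<noteq> []" and "hd e = 0"
  shows "contains_pattern e [0, 2, 1] \<longleftrightarrow> \<not> sorted (filter (\<lambda>x. 0 < x) e)"
proof
  assume "contains_pattern e [0, 2, 1]"
  then obtain a b c where abc: "subseq [a, b, c] e" "a < c" "c < b"
    by (auto simp only: contains_021)
  have "subseq [b, c] [a, b, c]"
    by simp
  then have "subseq [b, c] e"
    using abc(1) subseq_order.order_trans by blast
  then have "subseq (filter (\<lambda>x. 0 < x) [b, c]) (filter (\<lambda>x. 0 < x) e)"
    by (rule subseq_filter)
  then show "\<not> sorted (filter (\<lambda>x. 0 < x) e)"
    using abc by (force simp: sorted_iff_subseq)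
next
  assume "\<not> sorted (filter (\<lambda>x. 0 < x) e)"
  then obtain b c where bc: "subseq [b, c] (filter (\<lambda>x. 0 < x) e)" "c < b"
    by (auto simp: sorted_iff_subseq not_le)
  then have "c \<in> set (filter (\<lambda>x. 0 < x) e)"
    using subseq_order.order_trans[of "[c]" "[b, c]"] by (fastforce simp: subseq_singleton_left)
  then have "0 < c"
    by simp
  have "subseq [b, c] e"
    using bc(1) subseq_filter_left subseq_order.order_trans by blast
  moreover obtain e' where e': "e = 0 # e'"
    using assms by (cases e) auto
  ultimately have "subseq [0, b, c] e"
    using \<open>c < b\<close> by (auto simp: subseq_Cons2_iff)
  then show "contains_pattern e [0, 2, 1]"
    using \<open>0 < c\<close> \<open>c < b\<close> unfolding contains_021 by blast
qed

lemma contains_100_iff: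
  assumes "sorted (filter (\<lambda>x. 0 < x) e)"
  shows "contains_pattern e [1, 0, 0] \<longleftrightarrow> 2 \<le> inner_zeros e"
proof
  assume "contains_pattern e [1, 0, 0]"
  then obtain a b where ab: "subseq [a, b, b] e" "b < a"
    by (auto simp only: contains_100)
  (* Otherwise all three letters are positive and form a descent. *)
  have "b = 0"
  proof (rule ccontr)
    assume "b \<noteq> 0"
    then have "subseq [a, b, b] (filter (\<lambda>x. 0 < x) e)"
      using subseq_filter[OF ab(1), of "\<lambda>x. 0 < x"] ab(2) by simp
    then have "subseq [a, b] (filter (\<lambda>x. 0 < x) e)"
      by (rule subseq_order.order_trans[rotated]) simp
    then show False
      using assms ab(2) by (meson sorted_iff_subseq leD)
  qed
  then have "subseq [a, 0, 0] (dropWhile (\<lambda>x. x = 0) e)"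
    using ab by (intro subseq_dropWhile) auto
  moreover have "subseq (replicate 2 0) [a, 0, 0]"
    by (simp add: eval_nat_numeral)
  ultimately have "subseq (replicate 2 0) (dropWhile (\<lambda>x. x = 0) e)"
    using subseq_order.order_trans by blast
  then show "2 \<le> inner_zeros e"
    by (simp only: subseq_replicate_iff_count_list inner_zeros_def)
next
  assume zeros: "2 \<le> inner_zeros e"
  then obtain a t where at: "dropWhile (\<lambda>x. x = 0) e = a # t"
    unfolding inner_zeros_def by (cases "dropWhile (\<lambda>x. x = 0) e") auto
  then have "a \<noteq> 0"
    using hd_dropWhile[of "\<lambda>x. x = 0" e] by simp
  then have "subseq (replicate 2 0) t"
    using zeros at by (simp only: subseq_replicate_iff_count_list) (simp add: inner_zeros_def)
  then have "subseq [a, 0, 0] (dropWhile (\<lambda>x. x = 0) e)"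
    using at by (simp add: eval_nat_numeral)
  moreover have "subseq (dropWhile (\<lambda>x. x = 0) e) e"
    by (metis list_emb_append2 subseq_order.order_refl takeWhile_dropWhile_id)
  ultimately have "subseq [a, 0, 0] e"
    using subseq_order.order_trans by blast
  then show "contains_pattern e [1, 0, 0]"
    using \<open>a \<noteq> 0\<close> unfolding contains_100 by blast
qed

section \<open>Enumeration by length, bound and number of inner zeros\<close>

text \<open>Inversion sequences with weakly increasing positive letters.  The empty word is included and
  the length is free, so that words can be built letter by letter.\<close>
definition admissible :: "nat list \<Rightarrow> bool" where
  "admissible e \<longleftrightarrow> (\<forall>i<length e. e ! i \<le> i) \<and> sorted (filter (\<lambda>x. 0 < x) e)"

text \<open>The bound \<open>m\<close> on the letters is cumulative (at most \<open>m\<close>, not maximum \<open>m\<close>); the words with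
  maximum \<open>m + 1\<close> are therefore a set difference.\<close>
definition admissibles :: "nat \<Rightarrow> nat \<Rightarrow> nat \<Rightarrow> nat list set" where
  "admissibles d N m =
     {e. admissible e \<and> length e = N \<and> set e \<subseteq> {..m} \<and> inner_zeros e = d}"

lemma admissible_snoc:
  "admissible (e @ [x]) \<longleftrightarrow>
     admissible e \<and> x \<le> length e \<and> (x = 0 \<or> (\<forall>y\<in>set e. y \<le> x))"
  by (auto simp: admissible_def nth_append All_less_Suc sorted_append)

lemma finite_admissibles [simp]: "finite (admissibles d N m)"
  by (rule finite_subset[OF _ finite_lists_length_eq[of "{..m}" N]])
     (auto simp: admissibles_def)

lemma admissibles_mono: "m \<le> m' \<Longrightarrow> admissibles d N m \<subseteq> admissibles d N m'"
  by (force simp: admissibles_def)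

lemma admissible_letter_less:
  assumes "admissible e" and "y \<in> set e"
  shows "y < length e"
  using assms by (auto simp: admissible_def in_set_conv_nth intro: le_less_trans)

lemma admissibles_length_Suc:
  "admissibles d (Suc N) (Suc N) = admissibles d (Suc N) N"
  using admissible_letter_less by (fastforce simp: admissibles_def)

lemma admissibles_0:
  "admissibles d N 0 = (if d = 0 then {replicate N 0} else {})"
proof -
  have zeros: "admissible (replicate N 0)" "inner_zeros (replicate N 0) = 0"
    by (auto simp: admissible_def inner_zeros_def)
  have "set e \<subseteq> {..0} \<and> length e = N \<longleftrightarrow> e = replicate N 0" for e :: "nat list"
    by (auto simp: subset_eq intro: replicate_eqI)
  then have "admissibles d N 0 =
      {e. e = replicate N 0 \<and> admissible e \<and> inner_zeros e = d}"
    unfolding admissibles_def by blast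
  with zeros show ?thesis
    by auto
qed

text \<open>A word with maximum \<open>m + 1\<close> ends in its maximum or in an inner zero; in the second case the
  word without this zero already has maximum \<open>m + 1\<close>.\<close>
lemma admissibles_Suc_Suc:
  assumes "Suc m \<le> N"
  shows "admissibles d (Suc N) (Suc m) =
     admissibles d (Suc N) m \<union> (\<lambda>e. e @ [Suc m]) ` admissibles d N (Suc m) \<union>
     (if d = 0 then {}
      else (\<lambda>e. e @ [0]) ` (admissibles (d - 1) N (Suc m) - admissibles (d - 1) N m))"
    (is "?L = ?A \<union> ?B \<union> ?C")
proof (intro equalityI subsetI)
  fix w assume w: "w \<in> ?L"
  then obtain e x where ex: "w = e @ [x]"
    by (cases w rule: rev_cases) (auto simp: admissibles_def)
  show "w \<in> ?A \<union> ?B \<union> ?C"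
  proof (cases "set w \<subseteq> {..m}")
    case True
    with w show ?thesis
      by (auto simp: admissibles_def)
  next
    case False
    then have top: "Suc m \<in> set w"
      using w by (auto simp: admissibles_def le_Suc_eq)
    show ?thesis
    proof (cases "x = 0")
      case True
      then have "Suc m \<in> set e"
        using top ex by auto
      moreover from this have zeros: "d = Suc (inner_zeros e)"
        using w ex True by (auto simp: admissibles_def inner_zeros_snoc)
      ultimately have "e \<in> admissibles (d - 1) N (Suc m) - admissibles (d - 1) N m"
        using w ex by (auto simp: admissibles_def admissible_snoc)
      then have "w \<in> ?C"
        using zeros ex True by simp
      then show ?thesis
        by blast
    next
      case False
      then have "x = Suc m"
        using top w ex by (auto simp: admissibles_def admissible_snoc intro: le_antisym)
      then have "w \<in> ?B"
        using w ex by (auto simp: admissibles_def admissible_snoc inner_zeros_snoc)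
      then show ?thesis
        by blast
    qed
  qed
next
  fix w assume "w \<in> ?A \<union> ?B \<union> ?C"
  then consider "w \<in> ?A" | "w \<in> ?B" | "w \<in> ?C"
    by blast
  then show "w \<in> ?L"
  proof cases
    case 1
    then show ?thesis
      using admissibles_mono[of m "Suc m" d "Suc N"] by auto
  next
    case 2
    then show ?thesis
      using assms by (auto simp: admissibles_def admissible_snoc inner_zeros_snoc)
  next
    case 3
    then obtain e where e: "d \<noteq> 0" "w = e @ [0]"
        "e \<in> admissibles (d - 1) N (Suc m)" "e \<notin> admissibles (d - 1) N m"
      by (auto split: if_splits)
    then have "Suc m \<in> set e"
      by (auto simp: admissibles_def le_Suc_eq)
    with e show ?thesis
      by (auto simp: admissibles_def admissible_snoc inner_zeros_snoc)
  qed
qed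

lemma card_admissibles_Suc_Suc:
  assumes "Suc m \<le> N"
  shows "card (admissibles d (Suc N) (Suc m)) =
     card (admissibles d (Suc N) m) + card (admissibles d N (Suc m)) +
     (if d = 0 then 0
      else card (admissibles (d - 1) N (Suc m)) - card (admissibles (d - 1) N m))"
proof -
  define B where "B = (\<lambda>e. e @ [Suc m]) ` admissibles d N (Suc m)"
  define C where "C = (if d = 0 then {}
      else (\<lambda>e. e @ [0]) ` (admissibles (d - 1) N (Suc m) - admissibles (d - 1) N m))"
  have "card B = card (admissibles d N (Suc m))"
    unfolding B_def by (rule card_image) (auto simp: inj_on_def)
  moreover have "card C = (if d = 0 then 0
      else card (admissibles (d - 1) N (Suc m)) - card (admissibles (d - 1) N m))"
    unfolding C_def
    by (auto simp: card_image inj_on_def card_Diff_subset admissibles_mono)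
  moreover have "admissibles d (Suc N) m \<inter> B = {}"
    by (auto simp: B_def admissibles_def)
  moreover have "(admissibles d (Suc N) m \<union> B) \<inter> C = {}"
    by (auto simp: B_def C_def admissibles_def split: if_splits)
  moreover have "finite B" "finite C"
    by (auto simp: B_def C_def)
  moreover have "admissibles d (Suc N) (Suc m) = admissibles d (Suc N) m \<union> B \<union> C"
    unfolding B_def C_def by (rule admissibles_Suc_Suc[OF assms])
  ultimately show ?thesis
    by (simp only: card_Un_disjoint finite_Un finite_admissibles simp_thms)
qed

section \<open>Solving the recurrence\<close>

lemma odd_binomial_middle: "Suc (2 * n) choose n = Suc (2 * n) choose Suc n"
  by (subst binomial_symmetric) auto

lemma binomial_Suc_mult:
  "real (Suc k) * real (n choose Suc k) = (real n - real k) * real (n choose k)"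
proof (cases "k \<le> n")
  case True
  have "Suc k * (n choose Suc k) = (n - k) * (n choose k)"
    by (cases n) (simp_all only: Suc_times_binomial binomial_absorb_comp, simp_all)
  then have "real (Suc k * (n choose Suc k)) = real ((n - k) * (n choose k))"
    by (rule arg_cong)
  then show ?thesis
    using True by (simp only: of_nat_mult of_nat_diff)
qed (simp add: binomial_eq_0)

lemma catalan_identity:
  "Suc n * (2 * n choose n) = Suc n * (2 * n choose Suc n) + (2 * n choose n)"
proof -
  have "real (Suc n * (2 * n choose n)) = real (Suc n * (2 * n choose Suc n) + (2 * n choose n))"
    using binomial_Suc_mult[of n "2 * n"] by (simp add: algebra_simps)
  then show ?thesis
    by (simp only: of_nat_eq_iff)
qed

text \<open>The formula extends to \<open>m = N\<close>, which the induction on the length uses: \<open>m\<close> then exceeds all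
  letters of a nonempty word, and the two values of the formula at \<open>N - 1\<close> and \<open>N\<close> agree.\<close>
lemma card_admissibles_0:
  "m \<le> N \<Longrightarrow> int (card (admissibles 0 N m)) =
     int ((N + m) choose N) - int ((N + m) choose Suc N)"
proof (induction N arbitrary: m)
  case 0
  then show ?case
    by (simp add: admissibles_0)
next
  case (Suc N)
  note shorter = Suc.IH
  have below: "int (card (admissibles 0 (Suc N) m)) =
      int ((Suc N + m) choose Suc N) - int ((Suc N + m) choose Suc (Suc N))"
    if "m \<le> N" for m
    using that
  proof (induction m)
    case 0
    then show ?case
      by (simp add: admissibles_0 binomial_eq_0)
  next
    case (Suc m)
    then show ?case
      using Suc.IH Suc.prems shorter[of "Suc m"]
      by (simp add: card_admissibles_Suc_Suc)
  qed
  show ?case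
  proof (cases "m \<le> N")
    case True
    then show ?thesis
      by (rule below)
  next
    case False
    with Suc.prems have m: "m = Suc N"
      by simp
    show ?thesis
      using odd_binomial_middle[of N]
      unfolding m admissibles_length_Suc below[OF order_refl] by (simp flip: mult_2)
  qed
qed

text \<open>The formula for one inner zero in words of length \<open>k + 1\<close> with letters at most \<open>m\<close> is, with
  \<open>n = k + m\<close>, \<open>(k + 1) ((n choose k) - (n choose k+1)) - (n+1 choose k) + (n choose k+1) + (n+1 choose k+3)\<close>.
  The source term of the recurrence is a difference of ballot numbers and itself solves the
  homogeneous recurrence, so multiplying it by the length gives a particular solution: this is the
  first summand.  The rest solves the homogeneous recurrence and is chosen such that the formula
  vanishes at \<open>m = 0\<close> and takes the same value at \<open>m = k\<close> and \<open>m = k + 1\<close>.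
  At \<open>m = k\<close>, where the bound on the letters is no restriction, it reduces to \<open>2k+1 choose k+3\<close>.\<close>
lemma diagonal_value:
  "int (Suc n) * (int (2 * n choose n) - int (2 * n choose Suc n))
     - int (Suc (2 * n) choose n) + int (2 * n choose Suc n) + int (Suc (2 * n) choose (n + 3)) =
   int (Suc (2 * n) choose (n + 3))"
  using arg_cong[OF catalan_identity, of int n] odd_binomial_middle[of n]
  by (simp only: of_nat_mult of_nat_add right_diff_distrib binomial_Suc_Suc)

lemma next_to_diagonal_value:
  "int (Suc n) * (int (2 * n choose n) - int (2 * n choose Suc n))
     - int (Suc (2 * n) choose n) + int (2 * n choose Suc n) + int (Suc (2 * n) choose (n + 3)) =
   int (Suc n) * (int (Suc (2 * n) choose n) - int (Suc (2 * n) choose Suc n))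
     - int (Suc (Suc (2 * n)) choose n) + int (Suc (2 * n) choose Suc n) + int (Suc (Suc (2 * n)) choose (n + 3))"
proof -
  have "Suc (Suc (2 * n)) choose n = Suc (Suc (2 * n)) choose Suc (Suc n)"
    by (subst binomial_symmetric) auto
  then show ?thesis
    unfolding diagonal_value using odd_binomial_middle[of n]
    by (simp add: numeral_3_eq_3)
qed

text \<open>The three groups on the right are the formula at \<open>(k + 1, m)\<close>, the formula at \<open>(k, m + 1)\<close> and
  the increment of the ballot numbers, where \<open>n = k + m + 1\<close>.\<close>
lemma one_inner_zero_recurrence:
  "int (Suc (Suc k)) * (int (Suc n choose Suc k) - int (Suc n choose Suc (Suc k)))
     - int (Suc (Suc n) choose Suc k) + int (Suc n choose Suc (Suc k)) + int (Suc (Suc n) choose Suc (k + 3)) =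
   (int (Suc (Suc k)) * (int (n choose Suc k) - int (n choose Suc (Suc k)))
     - int (Suc n choose Suc k) + int (n choose Suc (Suc k)) + int (Suc n choose Suc (k + 3)))
   + (int (Suc k) * (int (n choose k) - int (n choose Suc k))
     - int (Suc n choose k) + int (n choose Suc k) + int (Suc n choose (k + 3)))
   + ((int (Suc n choose Suc k) - int (Suc n choose Suc (Suc k)))
     - (int (n choose Suc k) - int (n choose Suc (Suc k))))"
  by (simp only: binomial_Suc_Suc of_nat_add of_nat_Suc) (simp add: algebra_simps)

lemma card_admissibles_1:
  "m \<le> Suc k \<Longrightarrow> int (card (admissibles 1 (Suc k) m)) =
     int (Suc k) * (int ((k + m) choose k) - int ((k + m) choose Suc k))
     - int (Suc (k + m) choose k) + int ((k + m) choose Suc k) + int (Suc (k + m) choose (k + 3))"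
proof (induction k arbitrary: m)
  case 0
  then consider "m = 0" | "m = 1"
    by linarith
  then show ?case
    using admissibles_0[of 1 1] admissibles_length_Suc[of 1 0] by cases (simp_all add: eval_nat_numeral)
next
  case (Suc k)
  note shorter = Suc.IH
  have below: "int (card (admissibles 1 (Suc (Suc k)) m)) =
      int (Suc (Suc k)) * (int ((Suc k + m) choose Suc k) - int ((Suc k + m) choose Suc (Suc k)))
      - int (Suc (Suc k + m) choose Suc k) + int ((Suc k + m) choose Suc (Suc k))
      + int (Suc (Suc k + m) choose (Suc k + 3))"
    if "m \<le> Suc k" for m
    using that
  proof (induction m)
    case 0
    then show ?case
      by (simp add: admissibles_0 binomial_eq_0)
  next
    case (Suc m)
    have "card (admissibles 0 (Suc k) m) \<le> card (admissibles 0 (Suc k) (Suc m))"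
      by (intro card_mono admissibles_mono) auto
    then have "int (card (admissibles 1 (Suc (Suc k)) (Suc m))) =
        int (card (admissibles 1 (Suc (Suc k)) m)) + int (card (admissibles 1 (Suc k) (Suc m)))
        + (int (card (admissibles 0 (Suc k) (Suc m))) - int (card (admissibles 0 (Suc k) m)))"
      using Suc.prems by (simp add: card_admissibles_Suc_Suc)
    then show ?case
      using Suc.IH Suc.prems shorter[of "Suc m"] card_admissibles_0[of "Suc m" "Suc k"]
        card_admissibles_0[of m "Suc k"] one_inner_zero_recurrence[of k "Suc (k + m)"]
      unfolding add_Suc add_Suc_right by linarith
  qed
  show ?case
  proof (cases "m \<le> Suc k")
    case True
    then show ?thesis
      by (rule below)
  next
    case False
    with Suc.prems have m: "m = Suc (Suc k)"
      by simp
    show ?thesis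
      unfolding m admissibles_length_Suc below[OF order_refl]
      using next_to_diagonal_value[of "Suc k"] by (simp only: mult_2 add_Suc_right)
  qed
qed

section \<open>The generating function of the central binomial coefficients\<close>

lemma central_binomial_Suc:
  "Suc n * (2 * Suc n choose Suc n) = (4 * n + 2) * (2 * n choose n)"
proof -
  have "2 * Suc n choose Suc n = (Suc (2 * n) choose n) + (Suc (2 * n) choose Suc n)"
    by simp
  also have "Suc (2 * n) choose n = Suc (2 * n) choose Suc n"
    by (rule odd_binomial_middle)
  finally have "Suc n * (2 * Suc n choose Suc n) = 2 * (Suc n * (Suc (2 * n) choose Suc n))"
    by (simp only: mult_2 add_mult_distrib2)
  then show ?thesis
    by (simp only: Suc_times_binomial) (simp add: algebra_simps)
qed

text \<open>The power series \<open>\<Sum>\<^sub>n (2n choose n) x\<^sup>n\<close>.\<close>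
definition central_binomial_fps :: "real fps" where
  "central_binomial_fps = Abs_fps (\<lambda>n. real (2 * n choose n))"

lemma central_binomial_fps_nth_Suc:
  "real (Suc n) * central_binomial_fps $ Suc n = (4 * real n + 2) * central_binomial_fps $ n"
  using arg_cong[OF central_binomial_Suc, of real n]
  unfolding central_binomial_fps_def by (simp only: of_nat_mult fps_nth_Abs_fps) simp

lemma fps_numeral_mult_nth:
  "(numeral k * f) $ n = numeral k * (f :: 'a :: comm_ring_1 fps) $ n"
  by (metis fps_mult_left_const_nth numeral_fps_const)

lemma central_binomial_fps_deriv:
  "(1 - 4 * fps_X) * fps_deriv central_binomial_fps = 2 * central_binomial_fps"
proof (rule fps_ext)
  fix n :: nat
  let ?D = central_binomial_fps
  have "(1 - 4 * fps_X) * fps_deriv ?D = fps_deriv ?D - 4 * (fps_X * fps_deriv ?D)"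
    by (simp add: algebra_simps)
  then have "((1 - 4 * fps_X) * fps_deriv ?D) $ n = real (Suc n) * ?D $ Suc n - 4 * real n * ?D $ n"
    by (simp add: fps_numeral_mult_nth)
  then show "((1 - 4 * fps_X) * fps_deriv ?D) $ n = (2 * ?D) $ n"
    using central_binomial_fps_nth_Suc[of n]
    by (simp only: fps_numeral_mult_nth) (simp add: algebra_simps)
qed

lemma central_binomial_fps_nth_0: "central_binomial_fps $ 0 = 1"
  by (simp add: central_binomial_fps_def)

lemma central_binomial_fps_square:
  "central_binomial_fps ^ 2 * (1 - 4 * fps_X) = 1"
proof -
  let ?D = central_binomial_fps
  have "fps_deriv (?D ^ 2 * (1 - 4 * fps_X)) =
      2 * ?D * ((1 - 4 * fps_X) * fps_deriv ?D - 2 * ?D)"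
    by (simp add: power2_eq_square algebra_simps)
  also have "\<dots> = fps_deriv 1"
    by (simp add: central_binomial_fps_deriv)
  finally show ?thesis
    unfolding fps_deriv_eq_iff by (simp add: power2_eq_square central_binomial_fps_nth_0)
qed

lemma central_binomial_fps_sqrt:
  "central_binomial_fps * fps_sqrt (1 - 4 * fps_X) = 1"
proof -
  let ?D = central_binomial_fps and ?S = "fps_sqrt (1 - 4 * fps_X)"
  have "?S ^ 2 = 1 - 4 * fps_X"
    unfolding fps_sqrt_def eval_nat_numeral
    by (rule power_radical[THEN iffD1]) auto
  then have "(?D * ?S) ^ 2 = 1"
    using central_binomial_fps_square by (simp add: power_mult_distrib)
  then have "?D * ?S = 1 \<or> ?D * ?S = -1"
    by (simp add: power2_eq_1_iff)
  (* The constant term 1 selects the branch of the square root. *)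
  moreover have "(?D * ?S) $ 0 \<noteq> (-1) $ 0"
    by (simp add: central_binomial_fps_nth_0 fps_sqrt_def)
  ultimately show ?thesis
    by metis
qed

section \<open>The enumeration and its generating function\<close>

lemma inv_seqs_avoiding_eq:
  "inv_seqs_avoiding n {[1, 0, 0], [0, 2, 1]} =
     admissibles 0 (Suc n) n \<union> admissibles 1 (Suc n) n"
proof -
  have "e \<in> inv_seqs_avoiding n {[1, 0, 0], [0, 2, 1]} \<longleftrightarrow>
      length e = Suc n \<and> admissible e \<and> inner_zeros e \<le> 1" for e
  proof (cases "length e = Suc n \<and> (\<forall>i\<le>n. e ! i \<le> i)")
    case True
    then have "e \<noteq> []" and "hd e = 0"
      by (auto simp: hd_conv_nth simp flip: length_greater_0_conv)
    with True show ?thesis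
      using contains_100_iff[of e] contains_021_iff[of e]
      by (auto simp: inv_seqs_avoiding_def inv_seqs_def admissible_def less_Suc_eq_le
          simp del: One_nat_def)
  qed (auto simp: inv_seqs_avoiding_def inv_seqs_def admissible_def less_Suc_eq_le)
  moreover have "set e \<subseteq> {..n}" if "admissible e" "length e = Suc n" for e
    using admissible_letter_less that by fastforce
  ultimately show ?thesis
    by (auto simp: admissibles_def)
qed

lemma card_inv_seqs_avoiding:
  "int (card (inv_seqs_avoiding n {[1, 0, 0], [0, 2, 1]})) =
     int (Suc (2 * n) choose n) - int (Suc (2 * n) choose (n + 2)) + int (Suc (2 * n) choose (n + 3))"
proof -
  have "card (inv_seqs_avoiding n {[1, 0, 0], [0, 2, 1]}) =
      card (admissibles 0 (Suc n) n) + card (admissibles 1 (Suc n) n)"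
    unfolding inv_seqs_avoiding_eq
    by (rule card_Un_disjoint[OF finite_admissibles finite_admissibles]) (auto simp: admissibles_def)
  then show ?thesis
    using card_admissibles_0[of n "Suc n"] card_admissibles_1[of n n] diagonal_value[of n]
      odd_binomial_middle[of n]
    by (simp add: mult_2)
qed

lemma card_inv_seqs_avoiding_closed_form:
  "real (card (inv_seqs_avoiding n {[1, 0, 0], [0, 2, 1]})) =
     (real n ^ 2 + real n + 6) / (2 * (real n + 3) * (real n + 2)) * real ((2 * n + 2) choose (n + 1))"
proof -
  define b where "b j = real (Suc (2 * n) choose j)" for j
  have b0: "b n = b (n + 1)"
    using odd_binomial_middle[of n] by (simp add: b_def)
  have b2: "b (n + 2) = real n / (real n + 2) * b (n + 1)"
    using binomial_Suc_mult[of "n + 1" "Suc (2 * n)"] by (simp add: b_def field_simps)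
  have b3: "b (n + 3) = (real n - 1) / (real n + 3) * b (n + 2)"
    using binomial_Suc_mult[of "n + 2" "Suc (2 * n)"]
    by (simp add: b_def field_simps eval_nat_numeral del: binomial_Suc_Suc)
  have b1: "real ((2 * n + 2) choose (n + 1)) = 2 * b (n + 1)"
    using odd_binomial_middle[of n] by (simp add: b_def)
  have "real (card (inv_seqs_avoiding n {[1, 0, 0], [0, 2, 1]})) = b n - b (n + 2) + b (n + 3)"
    using arg_cong[OF card_inv_seqs_avoiding[of n], of real_of_int] by (simp add: b_def)
  also have "\<dots> = (real n ^ 2 + real n + 6) / (2 * (real n + 3) * (real n + 2)) * (2 * b (n + 1))"
    unfolding b3 b2 b0 by (simp add: divide_simps) (simp add: algebra_simps power2_eq_square)
  finally show ?thesis
    unfolding b1 .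
qed

lemma R_gf_nth_Suc:
  "2 * R_gf $ Suc n = central_binomial_fps $ (n + 3) - 6 * central_binomial_fps $ (n + 2)
     + 9 * central_binomial_fps $ (n + 1)"
proof -
  let ?d = "\<lambda>n. central_binomial_fps $ n"
  have d2: "?d (n + 2) = (4 * real n + 6) / (real n + 2) * ?d (n + 1)"
    using central_binomial_fps_nth_Suc[of "n + 1"] by (simp add: field_simps)
  have d3: "?d (n + 3) = (4 * real n + 10) / (real n + 3) * ?d (n + 2)"
    using central_binomial_fps_nth_Suc[of "n + 2"] by (simp add: field_simps eval_nat_numeral)
  have "R_gf $ Suc n = (real n ^ 2 + real n + 6) / (2 * (real n + 3) * (real n + 2)) * ?d (n + 1)"
    using card_inv_seqs_avoiding_closed_form[of n]
    by (simp add: R_gf_def central_binomial_fps_def del: binomial_Suc_Suc One_nat_def)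
  then show ?thesis
    unfolding d3 d2 by (simp add: divide_simps) (simp add: algebra_simps power2_eq_square)
qed

lemma R_gf_eq:
  "2 * fps_X ^ 2 * R_gf = (1 - 3 * fps_X) ^ 2 * central_binomial_fps - (1 - 3 * fps_X) * (1 - fps_X)"
proof (rule fps_ext)
  fix n :: nat
  let ?D = central_binomial_fps
  have rhs: "(1 - 3 * fps_X) ^ 2 * ?D - (1 - 3 * fps_X) * (1 - fps_X) =
      ?D - 6 * (fps_X ^ 1 * ?D) + 9 * (fps_X ^ 2 * ?D) - (1 - 4 * fps_X ^ 1 + 3 * fps_X ^ 2)"
    by (simp add: algebra_simps power2_eq_square)
  (* The polynomial subtracted from the series only affects the coefficients below 3. *)
  have small: "?D $ 0 = 1" "?D $ Suc 0 = 2" "?D $ Suc (Suc 0) = 6" "R_gf $ 0 = 0"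
    by (simp_all add: central_binomial_fps_def R_gf_def eval_nat_numeral)
  have "n = 0 \<or> n = 1 \<or> n = 2 \<or> n = (n - 3) + 3"
    by linarith
  then consider "n = 0" | "n = 1" | "n = 2" | k where "n = k + 3"
    by blast
  then show "(2 * fps_X ^ 2 * R_gf) $ n =
      ((1 - 3 * fps_X) ^ 2 * ?D - (1 - 3 * fps_X) * (1 - fps_X)) $ n"
    unfolding rhs mult.assoc fps_sub_nth fps_add_nth fps_numeral_mult_nth fps_X_power_mult_nth
      fps_X_power_nth fps_one_nth
    by cases (use R_gf_nth_Suc in \<open>simp_all add: small numeral_2_eq_2 numeral_3_eq_3\<close>)
qed

theorem theorem4p3:
  shows "fps_to_fls R_gf =
           (1 - 3 * fls_X)^2 / (2 * fls_X^2 * fps_to_fls (fps_sqrt (1 - 4 * fps_X)))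
           - (1 - 3 * fls_X) * (1 - fls_X) / (2 * fls_X^2)
       \<and> (\<forall>n::nat. real (card (inv_seqs_avoiding n {[1,0,0], [0,2,1]})) =
            (real n^2 + real n + 6) / (2 * (real n + 3) * (real n + 2))
              * real ((2 * n + 2) choose (n + 1)))"
proof (intro conjI allI)
  let ?R = "fps_to_fls R_gf" and ?D = "fps_to_fls central_binomial_fps"
  let ?S = "fps_to_fls (fps_sqrt (1 - 4 * fps_X))"
  have "?D * ?S = 1"
    using arg_cong[OF central_binomial_fps_sqrt, of fps_to_fls] by (simp add: fls_times_fps_to_fls)
  then have S: "?S \<noteq> 0" "?D = 1 / ?S"
    by (auto simp: eq_divide_eq)
  have eq: "2 * fls_X ^ 2 * ?R = (1 - 3 * fls_X) ^ 2 * ?D - (1 - 3 * fls_X) * (1 - fls_X)"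
    using arg_cong[OF R_gf_eq, of fps_to_fls]
    by (simp add: fls_times_fps_to_fls fps_to_fls_power)
  have X: "2 * fls_X ^ 2 \<noteq> (0 :: real fls)"
    by simp
  show "?R = (1 - 3 * fls_X)^2 / (2 * fls_X^2 * ?S) - (1 - 3 * fls_X) * (1 - fls_X) / (2 * fls_X^2)"
    using eq X S(1) unfolding S(2) by (simp add: field_simps)
qed (rule card_inv_seqs_avoiding_closed_form)

end
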